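(* Let $f:\mathbb{R}^n\to\mathbb{R}$ be a differentiable function that is $L_s$-RSS, let $0<\gamma\le \frac{1}{L_s}$, and let $\mathbf{x}\in\mathbb{R}^n$ be a sparse vector with $\|\mathbf{x}\|_0\le s$, with any choice of $\mathcal{I}^{\mathbf{x}}_s$. Let $\mathbf{y}\in H_s(\mathbf{x}-\gamma\nabla f(\mathbf{x}))$, with any choice of $\mathcal{I}^{\mathbf{y}}_s$. Then $$\frac{1-L_s\gamma}{6\gamma}\,\|\mathbf{y}-\mathbf{x}\|_2^2\;\le\;\frac{\gamma}{2}(1-L_s\gamma)\,\big\|\nabla_{\mathcal{I}^{\mathbf{x}}_s\cup\mathcal{I}^{\mathbf{y}}_s}f(\mathbf{x})\big\|_2^2\;\le\; f(\mathbf{x})-f(\mathbf{y}).$$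
   Context: Here $s,n$ are integers with $1\le s<n$, and $\|\mathbf{x}\|_0$ is the number of nonzero entries of $\mathbf{x}$. RSS: a differentiable $f:\mathbb{R}^n\to\mathbb{R}$ is $L_s$-RSS (restricted strongly smooth with modulus $L_s>0$) if $f(\mathbf{y})\le f(\mathbf{x})+\langle\nabla f(\mathbf{x}),\mathbf{y}-\mathbf{x}\rangle+\frac{L_s}{2}\|\mathbf{y}-\mathbf{x}\|_2^2$ for all $\mathbf{x},\mathbf{y}\in\mathbb{R}^n$ with $\|\mathbf{x}\|_0\le s$ and $\|\mathbf{y}\|_0\le s$. Hard thresholding operator: $H_s(\mathbf{x})=\arg\min_{\|\mathbf{z}\|_0\le s}\|\mathbf{z}-\mathbf{x}\|_2$, a set of minimizers that may contain more than one element; $\mathbf{y}\in H_s(\mathbf{x})$ means $\mathbf{y}$ is any one of them. For $\mathbf{x}\in\mathbb{R}^n$, $\mathcal{I}^{\mathbf{x}}_s\subset\{1,\dots,n\}$ denotes a set of $s$ indices corresponding to the $s$ largest entries of $\mathbf{x}$ in absolute value (not unique when there are ties). For an index set $\mathcal{J}$, $\nabla_{\mathcal{J}}f(\mathbf{x})$ is the restriction of the gradient vector $\nabla f(\mathbf{x})$ to the entries indexed by $\mathcal{J}$. *)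

theory Defs
  imports "HOL-Analysis.Analysis"
begin

(* Meaningful only where f is differentiable; see GDERIV_grad. *)
definition grad :: "('a::real_inner \<Rightarrow> real) \<Rightarrow> 'a \<Rightarrow> 'a" where
  "grad f x = (THE D. GDERIV f x :> D)"

lemma GDERIV_grad:
  fixes f :: "'a::euclidean_space \<Rightarrow> real"
  assumes "f differentiable (at x)"
  shows "GDERIV f x :> grad f x"
proof -
  obtain f' where f': "(f has_derivative f') (at x)"
    using assms unfolding differentiable_def by blast
  interpret linear f'
    using f' by (rule has_derivative_linear)
  have "f' = (\<lambda>h. h \<bullet> adjoint f' 1)"
    using adjoint_works[OF linear_axioms] by auto
  with f' have ex: "GDERIV f x :> adjoint f' 1"
    unfolding gderiv_def by simp
  have "D = D'" if "GDERIV f x :> D" "GDERIV f x :> D'" for D D'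
    using has_derivative_unique[OF that[unfolded gderiv_def]]
    by (metis vector_eq_ldot)
  with ex have "\<exists>!D. GDERIV f x :> D"
    by blast
  then show ?thesis
    unfolding grad_def by (rule theI')
qed

definition l0norm :: "real ^ 'n \<Rightarrow> nat" where
  "l0norm x = card {i. x $ i \<noteq> 0}"

definition RSS :: "nat \<Rightarrow> real \<Rightarrow> (real ^ 'n \<Rightarrow> real) \<Rightarrow> bool" where
  "RSS s L f \<longleftrightarrow> L > 0 \<and>
     (\<forall>x y. l0norm x \<le> s \<longrightarrow> l0norm y \<le> s \<longrightarrow>
        f y \<le> f x + grad f x \<bullet> (y - x) + L / 2 * (norm (y - x))\<^sup>2)"

definition hard_threshold :: "nat \<Rightarrow> real ^ 'n \<Rightarrow> (real ^ 'n) set" where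
  "hard_threshold s x = {y. is_arg_min (\<lambda>z. norm (z - x)) (\<lambda>z. l0norm z \<le> s) y}"

(* With ties in absolute value there are several such index sets; this is the set of all of them. *)
definition top_index_sets :: "nat \<Rightarrow> real ^ 'n \<Rightarrow> 'n set set" where
  "top_index_sets s x = {J. card J = s \<and> (\<forall>i\<in>J. \<forall>j. j \<notin> J \<longrightarrow> \<bar>x $ j\<bar> \<le> \<bar>x $ i\<bar>)}"

end

theory Submission
  imports Defs
begin

text \<open>
  Write \<open>g\<close> for the gradient at \<open>x\<close>, \<open>u = x - \<gamma> *\<^sub>R g\<close> for the gradient step, and split the index set
  \<open>Ix \<union> Iy\<close> into \<open>A = Iy\<close> and \<open>B = Ix - Iy\<close>. Hard thresholding copies \<open>u\<close> on \<open>Iy\<close> and deletes it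
  elsewhere, so the step \<open>y - x\<close> is the plain gradient step \<open>- \<gamma> g\<close> on \<open>A\<close>, equals \<open>- x\<close> on \<open>B\<close>, and
  vanishes elsewhere. All the information about the uncontrolled part \<open>x\<^sub>B\<close> comes from comparing \<open>Iy\<close>
  with the competing index set \<open>Ix\<close>: as \<open>y\<close> is a closest sparse point to \<open>u\<close>, the energy of \<open>u\<close> on
  \<open>Iy\<close> is at least that on \<open>Ix\<close>. The common indices cancel and \<open>x\<close> vanishes on \<open>Iy - Ix\<close>, which leaves
  the exchange inequality
  \<open>\<parallel>x\<^sub>B - \<gamma> g\<^sub>B\<parallel>\<^sup>2 \<le> \<gamma>\<^sup>2 \<parallel>g\<parallel>\<^sup>2\<close> with the right-hand norm taken over \<open>Iy - Ix\<close>, and hence also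
  \<open>\<parallel>x\<^sub>B - \<gamma> g\<^sub>B\<parallel>\<^sup>2 \<le> \<gamma>\<^sup>2 \<parallel>g\<^sub>A\<parallel>\<^sup>2\<close>.

  Both estimates follow from it. Combined with \<open>\<parallel>a + b\<parallel>\<^sup>2 \<le> 2\<parallel>a\<parallel>\<^sup>2 + 2\<parallel>b\<parallel>\<^sup>2\<close> it controls \<open>\<parallel>x\<^sub>B\<parallel>\<^sup>2\<close>,
  hence the length of the step: \<open>\<parallel>y - x\<parallel>\<^sup>2\<close> is at most \<open>3 \<gamma>\<^sup>2\<close> times the gradient energy on
  \<open>Ix \<union> Iy\<close>, because \<open>\<parallel>g\<^sub>A\<parallel>\<^sup>2\<close> is counted once for the gradient step on \<open>A\<close> and twice in the bound on
  \<open>x\<^sub>B\<close>. This is the left inequality. Expanding the square in the exchange inequality instead bounds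
  the inner product of \<open>g\<^sub>B\<close> and \<open>x\<^sub>B\<close> from below; inserted into the restricted smoothness inequality
  for the sparse points \<open>x\<close> and \<open>y\<close>, it gives the decrease of \<open>f\<close>.
\<close>

lemma vanishes_off_top_index_set:
  assumes "l0norm x \<le> s" "I \<in> top_index_sets s x" "i \<notin> I"
  shows "x $ i = 0"
proof (rule ccontr)
  assume "x $ i \<noteq> 0"
  \<comment> \<open>Every entry on \<open>I\<close> dominates the one at \<open>i\<close>, so there would be \<open>s + 1\<close> nonzero entries.\<close>
  with assms have "insert i I \<subseteq> {j. x $ j \<noteq> 0}"
    by (force simp: top_index_sets_def)
  then have "card (insert i I) \<le> l0norm x"
    unfolding l0norm_def by (simp add: card_mono)
  with assms show False
    by (simp add: top_index_sets_def)
qed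

lemma power2_norm_vec: "(norm (v :: real ^ 'n))\<^sup>2 = (\<Sum>i\<in>UNIV. (v $ i)\<^sup>2)"
  unfolding power2_norm_eq_inner inner_vec_def by (simp add: power2_eq_square)

lemma sum_split_Compl:
  fixes h :: "'n::finite \<Rightarrow> real"
  shows "(\<Sum>i\<in>UNIV. h i) = (\<Sum>i\<in>I. h i) + (\<Sum>i\<in>-I. h i)"
  by (subst sum.union_disjoint[symmetric]) auto

text \<open>
  Truncating \<open>u\<close> to an index set of at most \<open>s\<close> elements gives an admissible competitor, whose squared
  distance to \<open>u\<close> is the energy of \<open>u\<close> off that set.
\<close>

lemma hard_threshold_le_truncation:
  fixes u y :: "real ^ 'n"
  assumes y: "y \<in> hard_threshold s u" and J: "card J \<le> s"
  shows "(norm (y - u))\<^sup>2 \<le> (\<Sum>i\<in>-J. (u $ i)\<^sup>2)"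
proof -
  define z :: "real ^ 'n" where "z = (\<chi> i. if i \<in> J then u $ i else 0)"
  have "l0norm z \<le> card J"
    unfolding l0norm_def z_def by (rule card_mono) auto
  with y J have "norm (y - u) \<le> norm (z - u)"
    unfolding hard_threshold_def is_arg_min_def by (simp add: not_less)
  then have "(norm (y - u))\<^sup>2 \<le> (norm (z - u))\<^sup>2"
    by (simp add: power_mono)
  also have "\<dots> = (\<Sum>i\<in>-J. (u $ i)\<^sup>2)"
    by (simp add: power2_norm_vec sum_split_Compl[of _ J] z_def)
  finally show ?thesis .
qed

text \<open>
  A thresholded vector vanishing off \<open>I\<close> has squared distance to \<open>u\<close> at least the energy of \<open>u\<close> off
  \<open>I\<close>. Competing with the truncation to \<open>I\<close> itself shows that nothing is added on \<open>I\<close>; competing with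
  the truncation to another set \<open>J\<close> then compares the two energies.
\<close>

lemma
  fixes u y :: "real ^ 'n"
  assumes y: "y \<in> hard_threshold s u" and I: "card I \<le> s" and off: "\<And>i. i \<notin> I \<Longrightarrow> y $ i = 0"
  shows hard_threshold_copies: "i \<in> I \<Longrightarrow> y $ i = u $ i"
    and hard_threshold_max_energy: "card J \<le> s \<Longrightarrow> (\<Sum>i\<in>J. (u $ i)\<^sup>2) \<le> (\<Sum>i\<in>I. (u $ i)\<^sup>2)"
proof -
  have split: "(norm (y - u))\<^sup>2 = (\<Sum>i\<in>I. (y $ i - u $ i)\<^sup>2) + (\<Sum>i\<in>-I. (u $ i)\<^sup>2)"
    by (simp add: power2_norm_vec sum_split_Compl[of _ I] off)
  have nonneg: "0 \<le> (\<Sum>i\<in>I. (y $ i - u $ i)\<^sup>2)"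
    by (simp add: sum_nonneg)
  have "(\<Sum>i\<in>I. (y $ i - u $ i)\<^sup>2) = 0"
    using hard_threshold_le_truncation[OF y I] split nonneg by linarith
  then show "y $ i = u $ i" if "i \<in> I"
    using that by (simp add: sum_nonneg_eq_0_iff)
  show "(\<Sum>i\<in>J. (u $ i)\<^sup>2) \<le> (\<Sum>i\<in>I. (u $ i)\<^sup>2)" if "card J \<le> s"
    using hard_threshold_le_truncation[OF y that] split nonneg
      sum_split_Compl[of "\<lambda>i. (u $ i)\<^sup>2" I] sum_split_Compl[of "\<lambda>i. (u $ i)\<^sup>2" J]
    by linarith
qed

text \<open>
  The exchange inequality: the indices in \<open>I \<inter> J\<close> cancel in the comparison of energies, and \<open>x\<close>
  vanishes on what remains of \<open>I\<close>. They are readmitted on the right at the end, because the estimates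
  below only involve the gradient energy on all of \<open>I\<close>.
\<close>

lemma hard_threshold_exchange:
  fixes x y g :: "real ^ 'n"
  assumes y: "y \<in> hard_threshold s (x - \<gamma> *\<^sub>R g)"
    and I: "card I \<le> s" "\<And>i. i \<notin> I \<Longrightarrow> y $ i = 0"
    and J: "card J \<le> s" "\<And>i. i \<notin> J \<Longrightarrow> x $ i = 0"
  shows "(\<Sum>i\<in>J - I. (x $ i - \<gamma> * g $ i)\<^sup>2) \<le> \<gamma>\<^sup>2 * (\<Sum>i\<in>I. (g $ i)\<^sup>2)"
proof -
  let ?e = "\<lambda>i. (x $ i - \<gamma> * g $ i)\<^sup>2"
  have "sum ?e J \<le> sum ?e I"
    using hard_threshold_max_energy[OF y I J(1)] by simp
  moreover have "sum ?e J = sum ?e (J - I) + sum ?e (I \<inter> J)"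
    by (subst sum.union_disjoint[symmetric]) (auto intro: sum.cong)
  moreover have "sum ?e I = sum ?e (I - J) + sum ?e (I \<inter> J)"
    by (subst sum.union_disjoint[symmetric]) (auto intro: sum.cong)
  ultimately have "sum ?e (J - I) \<le> sum ?e (I - J)"
    by linarith
  also have "\<dots> = (\<Sum>i\<in>I - J. \<gamma>\<^sup>2 * (g $ i)\<^sup>2)"
    by (rule sum.cong) (auto simp: J(2) power_mult_distrib)
  also have "\<dots> \<le> (\<Sum>i\<in>I. \<gamma>\<^sup>2 * (g $ i)\<^sup>2)"
    by (rule sum_mono2) auto
  finally show ?thesis
    by (simp add: sum_distrib_left)
qed

theorem corollary1:
  fixes f :: "real ^ 'n \<Rightarrow> real"
    and x y :: "real ^ 'n"
    and s :: nat
    and L \<gamma> :: real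
    and Ix Iy :: "'n set"
  assumes "1 \<le> s" and "s < CARD('n)"
    and "\<forall>z. f differentiable (at z)"
    and "RSS s L f"
    and "0 < \<gamma>" and "\<gamma> \<le> 1 / L"
    and "l0norm x \<le> s"
    and "Ix \<in> top_index_sets s x"
    and "y \<in> hard_threshold s (x - \<gamma> *\<^sub>R grad f x)"
    and "Iy \<in> top_index_sets s y"
  shows "(1 - L * \<gamma>) / (6 * \<gamma>) * (norm (y - x))\<^sup>2
           \<le> \<gamma> / 2 * (1 - L * \<gamma>) * (L2_set (\<lambda>i. grad f x $ i) (Ix \<union> Iy))\<^sup>2
       \<and> \<gamma> / 2 * (1 - L * \<gamma>) * (L2_set (\<lambda>i. grad f x $ i) (Ix \<union> Iy))\<^sup>2 \<le> f x - f y"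
proof -
  define g where "g = grad f x"
  define B where "B = Ix - Iy"
  define GA where "GA = (\<Sum>i\<in>Iy. (g $ i)\<^sup>2)"
  define GB where "GB = (\<Sum>i\<in>B. (g $ i)\<^sup>2)"
  define XB where "XB = (\<Sum>i\<in>B. (x $ i)\<^sup>2)"
  define P where "P = (\<Sum>i\<in>B. g $ i * x $ i)"
  have y: "y \<in> hard_threshold s (x - \<gamma> *\<^sub>R g)"
    using assms(9) by (simp add: g_def)
  have ly: "l0norm y \<le> s"
    using y by (simp add: hard_threshold_def is_arg_min_def)
  have cards: "card Ix \<le> s" "card Iy \<le> s"
    using assms by (auto simp: top_index_sets_def)
  note x0 = vanishes_off_top_index_set[OF assms(7,8)]
  note y0 = vanishes_off_top_index_set[OF ly assms(10)]
  have step_Iy: "y $ i - x $ i = - \<gamma> * g $ i" if "i \<in> Iy" for i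
    using hard_threshold_copies[OF y cards(2) y0 that] by simp
  have over_step: "(\<Sum>i\<in>UNIV. h i) = (\<Sum>i\<in>Iy. h i) + (\<Sum>i\<in>B. h i)"
    if "\<And>i. y $ i = x $ i \<Longrightarrow> h i = 0" for h :: "'n \<Rightarrow> real"
  proof -
    have "h i = 0" if "i \<notin> Iy" "i \<notin> Ix" for i
      using x0 y0 that by (intro \<open>\<And>i. y $ i = x $ i \<Longrightarrow> h i = 0\<close>) simp
    then have "(\<Sum>i\<in>B. h i) = (\<Sum>i\<in>-Iy. h i)"
      by (intro sum.mono_neutral_left) (auto simp: B_def)
    then show ?thesis
      by (simp add: sum_split_Compl[of h Iy])
  qed
  have L: "L > 0" and nonneg: "0 \<le> 1 - L * \<gamma>"
    using assms(4,6) by (auto simp: RSS_def field_simps)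
  have GX: "0 \<le> GA" "0 \<le> GB" "0 \<le> XB"
    by (auto simp: GA_def GB_def XB_def sum_nonneg)
  have grad_energy: "(L2_set (\<lambda>i. grad f x $ i) (Ix \<union> Iy))\<^sup>2 = GA + GB"
  proof -
    have "Ix \<union> Iy = Iy \<union> B"
      by (auto simp: B_def)
    then have "(\<Sum>i\<in>Ix \<union> Iy. (g $ i)\<^sup>2) = GA + GB"
      unfolding GA_def GB_def by (simp, intro sum.union_disjoint) (auto simp: B_def)
    then show ?thesis
      using GX by (simp add: L2_set_def g_def)
  qed
  have norm_step: "(norm (y - x))\<^sup>2 = \<gamma>\<^sup>2 * GA + XB"
    by (simp add: power2_norm_vec over_step GA_def XB_def step_Iy power_mult_distrib
        sum_distrib_left B_def y0)
  have inner_step: "g \<bullet> (y - x) = - \<gamma> * GA - P"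
    by (simp add: inner_vec_def over_step GA_def P_def step_Iy sum_distrib_left B_def y0
        sum_negf power2_eq_square mult.left_commute)
  have exchange: "(\<Sum>i\<in>B. (x $ i - \<gamma> * g $ i)\<^sup>2) \<le> \<gamma>\<^sup>2 * GA"
    unfolding GA_def B_def by (rule hard_threshold_exchange[OF y cards(2) y0 cards(1) x0])
  have expand: "(\<Sum>i\<in>B. (x $ i - \<gamma> * g $ i)\<^sup>2) = XB - 2 * \<gamma> * P + \<gamma>\<^sup>2 * GB"
    by (simp add: XB_def P_def GB_def power2_diff power_mult_distrib sum.distrib sum_subtractf
        sum_distrib_left algebra_simps)
  \<comment> \<open>The bound \<open>(a + b)\<^sup>2 \<le> 2 a\<^sup>2 + 2 b\<^sup>2\<close> with \<open>a = x $ i - \<gamma> * g $ i\<close> and \<open>b = \<gamma> * g $ i\<close>; the square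
      below is \<open>(a - b)\<^sup>2\<close>.\<close>
  have "XB \<le> (\<Sum>i\<in>B. 2 * (x $ i - \<gamma> * g $ i)\<^sup>2 + 2 * \<gamma>\<^sup>2 * (g $ i)\<^sup>2)"
    unfolding XB_def
  proof (rule sum_mono)
    fix i
    have "0 \<le> (x $ i - 2 * \<gamma> * g $ i)\<^sup>2"
      by simp
    then show "(x $ i)\<^sup>2 \<le> 2 * (x $ i - \<gamma> * g $ i)\<^sup>2 + 2 * \<gamma>\<^sup>2 * (g $ i)\<^sup>2"
      by (simp add: power2_eq_square algebra_simps)
  qed
  also have "\<dots> = 2 * (\<Sum>i\<in>B. (x $ i - \<gamma> * g $ i)\<^sup>2) + 2 * \<gamma>\<^sup>2 * GB"
    by (simp add: GB_def sum.distrib sum_distrib_left)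
  finally have "XB \<le> 2 * (\<gamma>\<^sup>2 * GA) + 2 * \<gamma>\<^sup>2 * GB"
    using exchange by linarith
  moreover have "0 \<le> \<gamma>\<^sup>2 * GB"
    using GX by simp
  ultimately have "(norm (y - x))\<^sup>2 \<le> 3 * \<gamma>\<^sup>2 * (GA + GB)"
    unfolding norm_step by (simp add: algebra_simps)
  then have "(1 - L * \<gamma>) / (6 * \<gamma>) * (norm (y - x))\<^sup>2
      \<le> (1 - L * \<gamma>) / (6 * \<gamma>) * (3 * \<gamma>\<^sup>2 * (GA + GB))"
    using nonneg \<open>0 < \<gamma>\<close> by (intro mult_left_mono) auto
  also have "\<dots> = \<gamma> / 2 * (1 - L * \<gamma>) * (GA + GB)"
    using \<open>0 < \<gamma>\<close> by (simp add: field_simps power2_eq_square)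
  finally have left: "(1 - L * \<gamma>) / (6 * \<gamma>) * (norm (y - x))\<^sup>2
      \<le> \<gamma> / 2 * (1 - L * \<gamma>) * (GA + GB)" .
  have P: "XB / (2 * \<gamma>) + \<gamma> / 2 * GB - \<gamma> / 2 * GA \<le> P"
    using exchange \<open>0 < \<gamma>\<close> unfolding expand by (simp add: field_simps power2_eq_square)
  have decrease: "\<gamma> * GA + P - L / 2 * (\<gamma>\<^sup>2 * GA + XB) \<le> f x - f y"
  proof -
    have "f y \<le> f x + g \<bullet> (y - x) + L / 2 * (norm (y - x))\<^sup>2"
      using assms(4,7) ly by (simp add: RSS_def g_def)
    then show ?thesis
      unfolding norm_step inner_step by simp
  qed
  \<comment> \<open>Inserting the lower bound for \<open>P\<close> leaves the claimed bound and two surplus terms, one from \<open>x\<^sub>B\<close>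
      and one from the gradient on \<open>B\<close>.\<close>
  have "\<gamma> * GA + (XB / (2 * \<gamma>) + \<gamma> / 2 * GB - \<gamma> / 2 * GA) - L / 2 * (\<gamma>\<^sup>2 * GA + XB)
      = \<gamma> / 2 * (1 - L * \<gamma>) * (GA + GB) + (1 - L * \<gamma>) * XB / (2 * \<gamma>) + L * \<gamma>\<^sup>2 / 2 * GB"
    using \<open>0 < \<gamma>\<close> by (simp add: field_simps power2_eq_square)
  moreover have "0 \<le> (1 - L * \<gamma>) * XB / (2 * \<gamma>)"
    using nonneg GX \<open>0 < \<gamma>\<close> by simp
  moreover have "0 \<le> L * \<gamma>\<^sup>2 / 2 * GB"
    using L GX by simp
  ultimately have "\<gamma> / 2 * (1 - L * \<gamma>) * (GA + GB) \<le> f x - f y"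
    using P decrease by linarith
  with left show ?thesis
    by (simp add: grad_energy)
qed

end
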